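(* Let $X$ be a compactum and let $\mu\in\mathcal K(X)$. Then $\mu$ is balanced (i.e. $\mu\in\mathcal{BK}(X)$) if and only if there exists a balanced capacity $\nu\in MBX$ such that $\mu(\varphi)=\int_X^{Ch}\varphi\,d\nu$ for each $\varphi\in C(X,[0,+\infty))$.
   Context: A compactum is a compact Hausdorff space. For a compactum $X$, $\mathcal F(X)$ is the family of all closed subsets of $X$. An (upper-semicontinuous) capacity on $X$ is a function $\nu:\mathcal F(X)\to[0,1]$ such that for all closed $F,G\subset X$: (1) $\nu(X)=1$, $\nu(\emptyset)=0$; (2) if $F\subset G$ then $\nu(F)\le\nu(G)$; (3) if $\nu(F)<a$ then there is an open set $O\supset F$ such that $\nu(B)<a$ for each compact $B\subset O$. $MX$ is the set of all capacities on $X$. A capacity $\nu\in MX$ is balanced if $\sum_{i=1}^n\lambda_i\nu(A_i)\le 1$ for all $n$, all non-negative real numbers $\lambda_1,\dots,\lambda_n$ and all closed $A_1,\dots,A_n\subset X$ with $\sum_{i=1}^n\lambda_i\chi_{A_i}\le 1_X$ pointwise ($\chi_A$ is the characteristic function of $A$, $1_X$ the constant function $1$). $MBX=MB(X)\subset MX$ is the set of balanced capacities. $C(X,[0,+\infty))$ is the set of continuous functions $X\to[0,+\infty)$ with pointwise order. For $f\in C(X,[0,+\infty))$ and $t\in[0,+\infty)$ put $f_t=f^{-1}([t,+\infty))$. The Choquet integral of $f$ with respect to $\nu\in MX$ is $\int_X^{Ch}f\,d\nu=\int_0^\infty\nu(f_t)\,dt$. Functions $\varphi,\psi$ on $X$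 are comonotone if $(\varphi(x_1)-\varphi(x_2))(\psi(x_1)-\psi(x_2))\ge0$ for all $x_1,x_2\in X$. $\mathcal K(X)$ is the set of functionals $\mu:C(X,[0,+\infty))\to[0,+\infty)$ such that: (1) $\mu(1_X)=1$; (2) $\mu(\varphi)\le\mu(\psi)$ whenever $\varphi\le\psi$; (3) $\mu(\psi+\varphi)=\mu(\psi)+\mu(\varphi)$ for all comonotone $\varphi,\psi$; (4) $\mu(c\varphi)=c\mu(\varphi)$ for all $c\in[0,+\infty)$ and all $\varphi$. A functional $\mu\in\mathcal K(X)$ is balanced if for all $n$, all non-negative real numbers $\lambda_1,\dots,\lambda_n$ and all closed subsets $A_1,\dots,A_n$ of $X$ with $\sum_{i=1}^n\lambda_i\chi_{A_i}\le1_X$ there exist $\varphi_1,\dots,\varphi_n\in C(X,[0,+\infty))$ such that $\chi_{A_i}\le\varphi_i$ for each $i$ and $\sum_{i=1}^n\lambda_i\mu(\varphi_i)\le1$. $\mathcal{BK}(X)$ is the set of balanced functionals in $\mathcal K(X)$. *)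

theory Defs
  imports "HOL-Analysis.Analysis"
begin

definition capacities :: "'a topology \<Rightarrow> ('a set \<Rightarrow> real) set" where
  "capacities X = {\<nu>.
     (\<forall>F. closedin X F \<longrightarrow> \<nu> F \<in> {0..1}) \<and>
     \<nu> (topspace X) = 1 \<and> \<nu> {} = 0 \<and>
     (\<forall>F G. closedin X F \<and> closedin X G \<and> F \<subseteq> G \<longrightarrow> \<nu> F \<le> \<nu> G) \<and>
     (\<forall>F a. closedin X F \<and> \<nu> F < a \<longrightarrow>
        (\<exists>U. openin X U \<and> F \<subseteq> U \<and> (\<forall>B. compactin X B \<and> B \<subseteq> U \<longrightarrow> \<nu> B < a)))}"

definition subpartition ::
  "'a topology \<Rightarrow> nat \<Rightarrow> (nat \<Rightarrow> real) \<Rightarrow> (nat \<Rightarrow> 'a set) \<Rightarrow> bool" where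
  "subpartition X n c A \<longleftrightarrow>
     (\<forall>i\<in>{1..n}. 0 \<le> c i) \<and> (\<forall>i\<in>{1..n}. closedin X (A i)) \<and>
     (\<forall>x\<in>topspace X. (\<Sum>i=1..n. c i * indicator (A i) x) \<le> 1)"

definition balanced_capacities :: "'a topology \<Rightarrow> ('a set \<Rightarrow> real) set" where
  "balanced_capacities X = {\<nu> \<in> capacities X.
     \<forall>n c A. subpartition X n c A \<longrightarrow> (\<Sum>i=1..n. c i * \<nu> (A i)) \<le> 1}"

definition nonneg_cfuns :: "'a topology \<Rightarrow> ('a \<Rightarrow> real) set" where
  "nonneg_cfuns X = {f. continuous_map X (top_of_set {0..}) f}"

text \<open>For a capacity \<open>\<nu>\<close> on a compactum and \<open>f \<in> nonneg_cfuns X\<close> the integrand is antitone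
  on \<open>{0..}\<close>, has values in \<open>{0..1}\<close> and vanishes for large \<open>t\<close>, so it is integrable.\<close>

definition choquet_integral :: "'a topology \<Rightarrow> ('a set \<Rightarrow> real) \<Rightarrow> ('a \<Rightarrow> real) \<Rightarrow> real" where
  "choquet_integral X \<nu> f = (LBINT t:{0..}. \<nu> {x \<in> topspace X. t \<le> f x})"

definition comonotone :: "'a topology \<Rightarrow> ('a \<Rightarrow> real) \<Rightarrow> ('a \<Rightarrow> real) \<Rightarrow> bool" where
  "comonotone X f g \<longleftrightarrow>
     (\<forall>x\<in>topspace X. \<forall>y\<in>topspace X. 0 \<le> (f x - f y) * (g x - g y))"

text \<open>Functions are total on the underlying type, but the pointwise order is only
  required on \<open>topspace X\<close>. Monotonicity therefore makes the value of a functional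
  independent of the values of its argument outside \<open>topspace X\<close>.\<close>

definition comonotone_functionals :: "'a topology \<Rightarrow> (('a \<Rightarrow> real) \<Rightarrow> real) set" where
  "comonotone_functionals X = {\<mu>.
     (\<forall>f\<in>nonneg_cfuns X. 0 \<le> \<mu> f) \<and>
     \<mu> (\<lambda>_. 1) = 1 \<and>
     (\<forall>f\<in>nonneg_cfuns X. \<forall>g\<in>nonneg_cfuns X.
        (\<forall>x\<in>topspace X. f x \<le> g x) \<longrightarrow> \<mu> f \<le> \<mu> g) \<and>
     (\<forall>f\<in>nonneg_cfuns X. \<forall>g\<in>nonneg_cfuns X.
        comonotone X f g \<longrightarrow> \<mu> (\<lambda>x. g x + f x) = \<mu> g + \<mu> f) \<and>
     (\<forall>c\<ge>0. \<forall>f\<in>nonneg_cfuns X. \<mu> (\<lambda>x. c * f x) = c * \<mu> f)}"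

definition balanced_functionals :: "'a topology \<Rightarrow> (('a \<Rightarrow> real) \<Rightarrow> real) set" where
  "balanced_functionals X = {\<mu> \<in> comonotone_functionals X.
     \<forall>n c A. subpartition X n c A \<longrightarrow>
       (\<exists>f. (\<forall>i\<in>{1..n}. f i \<in> nonneg_cfuns X \<and>
                (\<forall>x\<in>topspace X. indicator (A i) x \<le> f i x)) \<and>
            (\<Sum>i=1..n. c i * \<mu> (f i)) \<le> 1)}"

end

theory Submission imports Defs begin

text \<open>A functional \<open>\<mu>\<close> is represented by the capacity \<open>\<nu> F = inf {\<mu> \<phi> | \<chi>\<^sub>F \<le> \<phi>}\<close>: cutting \<open>f\<close> into
  horizontal slices, which are pairwise comonotone, shows that both \<open>\<mu> (min f b) - \<mu> (min f a)\<close> and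
  the integral of \<open>\<nu> {f \<ge> t}\<close> over \<open>{a..b}\<close> lie between \<open>(b - a) * \<nu> {f \<ge> b}\<close> and
  \<open>(b - a) * \<nu> {f \<ge> a}\<close>. Balancedness of \<open>\<mu>\<close> passes to \<open>\<nu>\<close> because \<open>\<nu> (A i) \<le> \<mu> (\<phi> i)\<close>.

  Conversely, in a normal space the closed sets of a subpartition can be thickened one after the
  other to closed neighbourhoods without losing the bound \<open>1\<close>. Urysohn functions supported in the
  thickened sets have superlevel sets that again form a subpartition, so integrating the
  balancedness inequality of \<open>\<nu>\<close> over the levels in \<open>{0<..1}\<close> gives that of \<open>\<mu>\<close>.\<close>

section \<open>Nonnegative continuous functions on a compact space\<close>

lemma nonneg_cfuns_iff:
  "f \<in> nonneg_cfuns X \<longleftrightarrow> continuous_map X euclideanreal f \<and> (\<forall>x\<in>topspace X. 0 \<le> f x)"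
  by (auto simp: nonneg_cfuns_def continuous_map_in_subtopology)

lemma closedin_superlevel:
  fixes f :: "'a \<Rightarrow> real"
  assumes "continuous_map X euclideanreal f"
  shows "closedin X {x \<in> topspace X. t \<le> f x}"
  using closedin_continuous_map_preimage[OF assms, of "{t..}"] by auto

lemma nonneg_cfuns_bounded:
  assumes "compact_space X" "f \<in> nonneg_cfuns X"
  obtains M where "0 \<le> M" "\<And>x. x \<in> topspace X \<Longrightarrow> f x \<le> M"
proof -
  have "compactin euclideanreal (f ` topspace X)"
    using assms by (intro image_compactin[of X]) (auto simp: nonneg_cfuns_iff compact_space_def)
  then have "bounded (f ` topspace X)"
    by (simp add: compact_imp_bounded)
  then obtain M where "\<forall>x\<in>topspace X. \<bar>f x\<bar> \<le> M"
    by (auto simp: bounded_iff)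
  \<comment> \<open>On an empty space the bound \<open>M\<close> obtained above may be negative,
    hence the maximum with 0.\<close>
  then show ?thesis
    by (intro that[of "max 0 M"]) fastforce+
qed

section \<open>The Choquet integrand\<close>

lemma capacity_superlevel_antimono:
  assumes "\<nu> \<in> capacities X" "f \<in> nonneg_cfuns X" "s \<le> t"
  shows "\<nu> {x \<in> topspace X. t \<le> f x} \<le> \<nu> {x \<in> topspace X. s \<le> f x}"
proof -
  have "closedin X {x \<in> topspace X. u \<le> f x}" for u
    using assms by (intro closedin_superlevel) (simp add: nonneg_cfuns_iff)
  moreover have "{x \<in> topspace X. t \<le> f x} \<subseteq> {x \<in> topspace X. s \<le> f x}"
    using assms(3) by auto
  ultimately show ?thesis
    using assms(1) by (simp add: capacities_def)
qed

lemma capacity_superlevel_bounds: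
  assumes "\<nu> \<in> capacities X" "f \<in> nonneg_cfuns X"
  shows "0 \<le> \<nu> {x \<in> topspace X. t \<le> f x}" "\<nu> {x \<in> topspace X. t \<le> f x} \<le> 1"
proof -
  have "closedin X {x \<in> topspace X. t \<le> f x}"
    using assms by (intro closedin_superlevel) (simp add: nonneg_cfuns_iff)
  then show "0 \<le> \<nu> {x \<in> topspace X. t \<le> f x}" "\<nu> {x \<in> topspace X. t \<le> f x} \<le> 1"
    using assms(1) unfolding capacities_def by auto
qed

lemma capacity_superlevel_eq_0:
  fixes f :: "'a \<Rightarrow> real"
  assumes "\<nu> \<in> capacities X" "\<And>x. x \<in> topspace X \<Longrightarrow> f x \<le> M" "M < t"
  shows "\<nu> {x \<in> topspace X. t \<le> f x} = 0"
proof -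
  have empty: "{x \<in> topspace X. t \<le> f x} = {}"
    using assms(2,3) by force
  show ?thesis
    unfolding empty using assms(1) by (simp add: capacities_def)
qed

lemma borel_measurable_capacity_superlevel:
  assumes "\<nu> \<in> capacities X" "f \<in> nonneg_cfuns X"
  shows "(\<lambda>t. \<nu> {x \<in> topspace X. t \<le> f x}) \<in> borel_measurable borel"
proof -
  have "mono (\<lambda>t. - \<nu> {x \<in> topspace X. t \<le> f x})"
    using capacity_superlevel_antimono[OF assms] by (intro monoI) simp
  then have "(\<lambda>t. - \<nu> {x \<in> topspace X. t \<le> f x}) \<in> borel_measurable borel"
    by (rule borel_measurable_mono)
  then show ?thesis
    by (simp add: borel_measurable_uminus_eq)
qed

lemma set_integrable_capacity_superlevel:
  assumes "\<nu> \<in> capacities X" "f \<in> nonneg_cfuns X"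
  shows "set_integrable lborel {a..b} (\<lambda>t. \<nu> {x \<in> topspace X. t \<le> f x})"
proof (rule set_integrable_bound[where f = "\<lambda>_. 1 :: real"])
  show "set_integrable lborel {a..b} (\<lambda>_. 1 :: real)"
    by (simp add: set_integrable_def integrable_indicator_iff emeasure_lborel_Icc_eq)
  show "set_borel_measurable lborel {a..b} (\<lambda>t. \<nu> {x \<in> topspace X. t \<le> f x})"
    unfolding set_borel_measurable_def using borel_measurable_capacity_superlevel[OF assms]
    by (intro borel_measurable_scaleR borel_measurable_indicator) simp_all
  show "AE t in lborel. t \<in> {a..b} \<longrightarrow> norm (\<nu> {x \<in> topspace X. t \<le> f x}) \<le> norm (1 :: real)"
    using capacity_superlevel_bounds[OF assms] by (intro AE_I2) (simp del: atLeastAtMost_iff)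
qed

text \<open>Superlevel sets above the bound \<open>M\<close> are empty and have capacity 0, so the
  half-line can be cut down to \<open>{0..M}\<close>, an interval on which the integrand is known to
  be integrable.\<close>

lemma choquet_integral_eq_bounded:
  assumes "\<nu> \<in> capacities X" "\<And>x. x \<in> topspace X \<Longrightarrow> f x \<le> M"
  shows "choquet_integral X \<nu> f = (LBINT t:{0..M}. \<nu> {x \<in> topspace X. t \<le> f x})"
proof -
  have "indicator {0..} t *\<^sub>R \<nu> {x \<in> topspace X. t \<le> f x}
      = indicator {0..M} t *\<^sub>R \<nu> {x \<in> topspace X. t \<le> f x}" for t :: real
    using capacity_superlevel_eq_0[OF assms, where t = t] by (auto simp: indicator_def)
  then show ?thesis
    unfolding choquet_integral_def set_lebesgue_integral_def by (simp only:)
qed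

section \<open>Representation of comonotonically additive functionals\<close>

text \<open>Over \<open>n\<close> equal steps from 0 to \<open>M\<close> the bounds on the
  increments telescope to \<open>M / n * (h 0 - h M)\<close>, which tends to 0 as \<open>n\<close>
  grows. This takes the place of comparing upper and lower Riemann sums.\<close>

lemma eq_if_increment_bounded_by_antimono:
  fixes D h :: "real \<Rightarrow> real"
  assumes "0 \<le> M"
    and incr: "\<And>a b. 0 \<le> a \<Longrightarrow> a \<le> b \<Longrightarrow> \<bar>D b - D a\<bar> \<le> (b - a) * (h a - h b)"
  shows "D M = D 0"
proof (rule ccontr)
  assume "D M \<noteq> D 0"
  \<comment> \<open>By the Archimedean property, \<open>n\<close> is so large that the telescoped
    bound falls below the supposed gap.\<close>
  then obtain n :: nat where n: "M * (h 0 - h M) < of_nat n * \<bar>D M - D 0\<bar>"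
    using ex_less_of_nat_mult[of "\<bar>D M - D 0\<bar>"] by auto
  have "0 \<le> M * (h 0 - h M)"
    using incr[of 0 M] assms(1) by simp
  with n have "0 < n"
    by (cases n) auto
  define p where "p k = of_nat k * M / of_nat n" for k :: nat
  have p: "p 0 = 0" "p n = M" "\<And>k. 0 \<le> p k" "\<And>k. p (Suc k) - p k = M / of_nat n"
    using \<open>0 < n\<close> assms(1) by (auto simp: p_def field_simps)
  have mono: "p k \<le> p (Suc k)" for k
    using p(4)[of k] assms(1) by (metis diff_ge_0_iff_ge divide_nonneg_nonneg of_nat_0_le_iff)
  have "\<bar>D M - D 0\<bar> = \<bar>\<Sum>k<n. D (p (Suc k)) - D (p k)\<bar>"
    using p(1,2) by (simp add: sum_lessThan_telescope[of "\<lambda>k. D (p k)"])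
  also have "\<dots> \<le> (\<Sum>k<n. (M / of_nat n) * (h (p k) - h (p (Suc k))))"
    using incr[OF p(3) mono] by (intro order_trans[OF sum_abs] sum_mono) (simp add: p(4))
  also have "\<dots> = M / of_nat n * (h 0 - h M)"
    using sum_lessThan_telescope'[of "\<lambda>k. h (p k)" n]
    unfolding sum_distrib_left[symmetric] p(1,2) by (simp only:)
  finally show False
    using n \<open>0 < n\<close> by (simp add: field_simps)
qed

section \<open>The capacity induced by a functional\<close>

locale comonotone_functional =
  fixes X :: "'a topology" and \<mu> :: "('a \<Rightarrow> real) \<Rightarrow> real"
  assumes \<mu>: "\<mu> \<in> comonotone_functionals X"
begin

lemma nonneg: "f \<in> nonneg_cfuns X \<Longrightarrow> 0 \<le> \<mu> f"
  and one: "\<mu> (\<lambda>_. 1) = 1"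
  and mono: "\<lbrakk>f \<in> nonneg_cfuns X; g \<in> nonneg_cfuns X; \<And>x. x \<in> topspace X \<Longrightarrow> f x \<le> g x\<rbrakk> \<Longrightarrow> \<mu> f \<le> \<mu> g"
  and add: "\<lbrakk>f \<in> nonneg_cfuns X; g \<in> nonneg_cfuns X; comonotone X f g\<rbrakk> \<Longrightarrow> \<mu> (\<lambda>x. g x + f x) = \<mu> g + \<mu> f"
  and scale: "\<lbrakk>0 \<le> c; f \<in> nonneg_cfuns X\<rbrakk> \<Longrightarrow> \<mu> (\<lambda>x. c * f x) = c * \<mu> f"
  using \<mu> by (simp_all add: comonotone_functionals_def)

lemma const_mem: "0 \<le> c \<Longrightarrow> (\<lambda>_. c) \<in> nonneg_cfuns X"
  by (simp add: nonneg_cfuns_iff)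

lemma zero: "\<mu> (\<lambda>_. 0) = 0"
  using scale[OF order.refl const_mem[of 0]] by simp

definition majorants :: "'a set \<Rightarrow> ('a \<Rightarrow> real) set" where
  "majorants F = {\<phi> \<in> nonneg_cfuns X. \<forall>x\<in>topspace X. indicator F x \<le> \<phi> x}"

text \<open>The real infimum is meaningful because the family is nonempty (it contains the constant
  1) and its values are bounded below by 0.\<close>

definition capacity_of :: "'a set \<Rightarrow> real" where
  "capacity_of F = (INF \<phi>\<in>majorants F. \<mu> \<phi>)"

lemma one_majorant: "(\<lambda>_. 1) \<in> majorants F"
  using const_mem[of 1] by (simp add: majorants_def indicator_def)

lemma bdd_below_majorants: "bdd_below (\<mu> ` majorants F)"
  using nonneg by (auto intro!: bdd_belowI[of _ 0] simp: majorants_def)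

lemma capacity_of_le: "\<phi> \<in> majorants F \<Longrightarrow> capacity_of F \<le> \<mu> \<phi>"
  unfolding capacity_of_def by (intro cINF_lower bdd_below_majorants)

lemma le_capacity_of: "(\<And>\<phi>. \<phi> \<in> majorants F \<Longrightarrow> a \<le> \<mu> \<phi>) \<Longrightarrow> a \<le> capacity_of F"
  unfolding capacity_of_def using one_majorant by (intro cINF_greatest) auto

lemma capacity_of_less: "capacity_of F < a \<Longrightarrow> \<exists>\<phi>\<in>majorants F. \<mu> \<phi> < a"
  using le_capacity_of[of F a] by (meson not_le)

lemma majorants_antimono: "F \<subseteq> G \<Longrightarrow> majorants G \<subseteq> majorants F"
  unfolding majorants_def by (auto intro: order_trans[OF indicator_leI])

text \<open>A majorant \<phi> of F with value below a leaves room for a factor c > 1. The function c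
  * \<phi> is still of value below a, but it now majorizes every subset of an open set containing
  F.\<close>

lemma capacity_of_upper_semicontinuous:
  assumes "capacity_of F < a" "F \<subseteq> topspace X"
  shows "\<exists>U. openin X U \<and> F \<subseteq> U \<and> (\<forall>B. compactin X B \<and> B \<subseteq> U \<longrightarrow> capacity_of B < a)"
proof -
  obtain \<phi> where \<phi>: "\<phi> \<in> nonneg_cfuns X" "\<forall>x\<in>topspace X. indicator F x \<le> \<phi> x" "\<mu> \<phi> < a"
    using capacity_of_less[OF assms(1)] by (auto simp: majorants_def)
  obtain c where c: "1 < c" "c * \<mu> \<phi> < a"
  proof -
    have "((\<lambda>c. c * \<mu> \<phi>) \<longlongrightarrow> 1 * \<mu> \<phi>) (at_right 1)"
      by (intro tendsto_intros)
    then have "\<forall>\<^sub>F c in at_right 1. c * \<mu> \<phi> < a"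
      using \<phi>(3) by (intro order_tendstoD) auto
    with eventually_at_right_less[of "1::real"] have "\<forall>\<^sub>F c in at_right 1. 1 < c \<and> c * \<mu> \<phi> < a"
      by eventually_elim simp
    then show ?thesis
      using that eventually_happens'[OF trivial_limit_at_right_real] by blast
  qed
  \<comment> \<open>This is the set where c * \<phi> exceeds 1; it contains F since \<phi> is at
    least 1 > 1 / c there.\<close>
  define U where "U = {x \<in> topspace X. \<phi> x \<in> {1 / c <..}}"
  have "openin X U"
    using \<phi>(1) unfolding U_def nonneg_cfuns_iff
    by (intro openin_continuous_map_preimage[of X euclideanreal]) auto
  moreover have "F \<subseteq> U"
  proof
    fix x assume "x \<in> F"
    then have "x \<in> topspace X" "1 \<le> \<phi> x"
      using \<phi>(2) assms(2) by force+
    moreover have "1 / c < 1"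
      using c(1) by simp
    ultimately show "x \<in> U"
      by (simp add: U_def)
  qed
  moreover have "capacity_of B < a" if "B \<subseteq> U" for B
  proof -
    have "indicator B x \<le> c * \<phi> x" if "x \<in> topspace X" for x
      using that \<open>B \<subseteq> U\<close> c(1) \<phi>(1)
      by (auto simp: U_def nonneg_cfuns_iff indicator_def field_simps subset_iff less_imp_le)
    then have "(\<lambda>x. c * \<phi> x) \<in> majorants B"
      using \<phi>(1) c(1) by (auto simp: majorants_def nonneg_cfuns_iff intro: continuous_map_real_mult)
    then have "capacity_of B \<le> c * \<mu> \<phi>"
      using capacity_of_le scale[of c \<phi>] \<phi>(1) c(1) by force
    then show ?thesis
      using c(2) by simp
  qed
  ultimately show ?thesis
    by blast
qed

lemma capacity_of_in_capacities: "capacity_of \<in> capacities X"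
proof -
  have "capacity_of (topspace X) = 1"
  proof (rule antisym)
    show "capacity_of (topspace X) \<le> 1"
      using capacity_of_le[OF one_majorant] one by simp
    show "1 \<le> capacity_of (topspace X)"
    proof (rule le_capacity_of)
      fix \<phi> assume "\<phi> \<in> majorants (topspace X)"
      then have "\<mu> (\<lambda>_. 1) \<le> \<mu> \<phi>"
        using const_mem[of 1] by (intro mono) (auto simp: majorants_def)
      then show "1 \<le> \<mu> \<phi>"
        by (simp add: one)
    qed
  qed
  moreover have "capacity_of {} = 0"
  proof (rule antisym)
    show "capacity_of {} \<le> 0"
      using capacity_of_le[of "\<lambda>_. 0" "{}"] const_mem[of 0] zero by (simp add: majorants_def)
    show "0 \<le> capacity_of {}"
      using nonneg by (intro le_capacity_of) (auto simp: majorants_def)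
  qed
  moreover have "capacity_of F \<le> capacity_of G" if "F \<subseteq> G" for F G
    using majorants_antimono[OF that] by (intro le_capacity_of capacity_of_le) blast
  moreover have "capacity_of F \<in> {0..1}" for F
    using capacity_of_le[OF one_majorant] one nonneg
    by (auto intro!: le_capacity_of simp: majorants_def)
  ultimately show ?thesis
    using capacity_of_upper_semicontinuous[OF _ closedin_subset] by (simp add: capacities_def)
qed

section \<open>Horizontal slices and the Choquet representation\<close>

lemma min_mem:
  assumes "f \<in> nonneg_cfuns X" "0 \<le> s"
  shows "(\<lambda>x. min (f x) s) \<in> nonneg_cfuns X"
  using assms by (auto simp: nonneg_cfuns_iff intro!: continuous_map_real_min)

text \<open>By comonotone additivity the difference is the value of the slice g = min f b - min f a.
  Divided by b - a, this slice majorizes the indicator of {f \<ge> b}. Conversely, g vanishes where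
  f < a and never exceeds b - a, so (b - a) * \<phi> dominates g for every majorant \<phi> of {f
  \<ge> a}; taking the infimum over \<phi> gives the upper bound.\<close>

lemma slice_bounds:
  assumes f: "f \<in> nonneg_cfuns X" and ab: "0 \<le> a" "a \<le> b"
  defines "h \<equiv> \<lambda>t. capacity_of {x \<in> topspace X. t \<le> f x}"
  shows "(b - a) * h b \<le> \<mu> (\<lambda>x. min (f x) b) - \<mu> (\<lambda>x. min (f x) a)"
    and "\<mu> (\<lambda>x. min (f x) b) - \<mu> (\<lambda>x. min (f x) a) \<le> (b - a) * h a"
proof -
  define g where "g x = min (f x) b - min (f x) a" for x
  have cont: "continuous_map X euclideanreal f"
    using f by (simp add: nonneg_cfuns_iff)
  have g: "g \<in> nonneg_cfuns X"
    using cont ab unfolding nonneg_cfuns_iff g_def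
    by (auto intro!: continuous_map_diff continuous_map_real_min)
  \<comment> \<open>Both functions are nondecreasing functions of f, so their increments never have
    opposite signs.\<close>
  have "comonotone X g (\<lambda>x. min (f x) a)"
    using ab unfolding comonotone_def g_def by (auto simp: min_def zero_le_mult_iff)
  then have "\<mu> (\<lambda>x. min (f x) a + g x) = \<mu> (\<lambda>x. min (f x) a) + \<mu> g"
    using g min_mem[OF f ab(1)] by (rule add[rotated 2])
  moreover have "(\<lambda>x. min (f x) a + g x) = (\<lambda>x. min (f x) b)"
    by (simp add: g_def)
  ultimately have \<mu>g: "\<mu> (\<lambda>x. min (f x) b) - \<mu> (\<lambda>x. min (f x) a) = \<mu> g"
    by simp
  have "(b - a) * h b \<le> \<mu> g \<and> \<mu> g \<le> (b - a) * h a"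
  proof (cases "a = b")
    \<comment> \<open>The empty slice is treated apart because the other case divides by b -
      a.\<close>
    case True
    then have "g = (\<lambda>_. 0)"
      by (simp add: g_def fun_eq_iff)
    then show ?thesis
      using zero True by simp
  next
    case False
    then have "0 < b - a"
      using ab by simp
    have "(\<lambda>x. (1 / (b - a)) * g x) \<in> nonneg_cfuns X"
      using g \<open>0 < b - a\<close> by (auto simp: nonneg_cfuns_iff intro!: continuous_map_real_mult
          simp del: times_divide_eq_left mult_1)
    moreover have "indicator {x \<in> topspace X. b \<le> f x} x \<le> (1 / (b - a)) * g x"
      if "x \<in> topspace X" for x
      using that g ab \<open>0 < b - a\<close> by (cases "b \<le> f x") (auto simp: nonneg_cfuns_iff g_def)
    ultimately have "(\<lambda>x. (1 / (b - a)) * g x) \<in> majorants {x \<in> topspace X. b \<le> f x}"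
      by (simp add: majorants_def)
    then have "h b \<le> (1 / (b - a)) * \<mu> g"
      unfolding h_def using capacity_of_le scale[OF _ g, of "1 / (b - a)"] \<open>0 < b - a\<close> by force
    moreover have "\<mu> g / (b - a) \<le> h a"
      unfolding h_def
    proof (rule le_capacity_of)
      fix \<phi> assume \<phi>: "\<phi> \<in> majorants {x \<in> topspace X. a \<le> f x}"
      then have mem: "\<phi> \<in> nonneg_cfuns X"
        by (simp add: majorants_def)
      have "\<mu> g \<le> \<mu> (\<lambda>x. (b - a) * \<phi> x)"
      proof (rule mono[OF g])
        show "(\<lambda>x. (b - a) * \<phi> x) \<in> nonneg_cfuns X"
          using mem \<open>0 < b - a\<close> by (auto simp: nonneg_cfuns_iff intro: continuous_map_real_mult)
        fix x assume x: "x \<in> topspace X"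
        show "g x \<le> (b - a) * \<phi> x"
        proof (cases "a \<le> f x")
          case True
          then have "1 \<le> \<phi> x"
            using \<phi> x by (force simp: majorants_def)
          then have "(b - a) * 1 \<le> (b - a) * \<phi> x"
            using \<open>0 < b - a\<close> by (intro mult_left_mono) auto
          moreover have "g x \<le> b - a"
            using True by (simp add: g_def)
          ultimately show ?thesis
            by simp
        next
          case False
          then have "g x = 0"
            using ab by (simp add: g_def)
          moreover have "0 \<le> \<phi> x"
            using mem x by (simp add: nonneg_cfuns_iff)
          ultimately show ?thesis
            using \<open>0 < b - a\<close> by simp
        qed
      qed
      then show "\<mu> g / (b - a) \<le> \<mu> \<phi>"
        using scale[OF _ mem, of "b - a"] \<open>0 < b - a\<close> by (simp add: field_simps)
    qed
    ultimately show ?thesis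
      using \<open>0 < b - a\<close> by (simp add: field_simps)
  qed
  then show "(b - a) * h b \<le> \<mu> (\<lambda>x. min (f x) b) - \<mu> (\<lambda>x. min (f x) a)"
    and "\<mu> (\<lambda>x. min (f x) b) - \<mu> (\<lambda>x. min (f x) a) \<le> (b - a) * h a"
    by (simp_all add: \<mu>g)
qed

text \<open>Truncate f at height s and compare the value of the functional with the integral over
  {0..s}. The discrepancy \<open>D s\<close> vanishes at 0 and has increments controlled by the
  slice bounds, hence it vanishes at an upper bound M of f, where truncation changes nothing on the
  space.\<close>

theorem choquet_representation:
  assumes "compact_space X" and f: "f \<in> nonneg_cfuns X"
  shows "\<mu> f = choquet_integral X capacity_of f"
proof -
  obtain M where M: "0 \<le> M" "\<And>x. x \<in> topspace X \<Longrightarrow> f x \<le> M"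
    using nonneg_cfuns_bounded[OF assms] by blast
  define h where "h t = capacity_of {x \<in> topspace X. t \<le> f x}" for t
  have int: "set_integrable lborel {a..b} h" for a b
    using set_integrable_capacity_superlevel[OF capacity_of_in_capacities f] by (simp add: h_def[abs_def])
  have anti: "s \<le> t \<Longrightarrow> h t \<le> h s" for s t
    using capacity_superlevel_antimono[OF capacity_of_in_capacities f] by (simp add: h_def)
  \<comment> \<open>Passing to the gauge integral makes additivity over adjacent intervals
    available.\<close>
  note int_on = set_borel_integral_eq_integral(1)[OF int]
  define D where "D s = \<mu> (\<lambda>x. min (f x) s) - integral {0..s} h" for s
  have "D M = D 0"
  proof (rule eq_if_increment_bounded_by_antimono[OF M(1)])
    fix a b :: real assume ab: "0 \<le> a" "a \<le> b"
    have "integral {0..b} h - integral {0..a} h = integral {a..b} h"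
      using Henstock_Kurzweil_Integration.integral_combine[OF ab int_on] by simp
    moreover have "integral {a..b} (\<lambda>_. h b) \<le> integral {a..b} h"
      by (intro integral_le int_on) (auto intro: anti)
    moreover have "integral {a..b} h \<le> integral {a..b} (\<lambda>_. h a)"
      by (intro integral_le int_on) (auto intro: anti)
    ultimately have "(b - a) * h b \<le> integral {0..b} h - integral {0..a} h"
      "integral {0..b} h - integral {0..a} h \<le> (b - a) * h a"
      using ab by auto
    \<comment> \<open>Both increments lie in the interval from (b - a) * h b to (b - a) * h a, so
      they differ by at most its length.\<close>
    with slice_bounds[OF f ab] show "\<bar>D b - D a\<bar> \<le> (b - a) * (h a - h b)"
      unfolding D_def h_def[symmetric] right_diff_distrib by linarith
  qed
  moreover have "D 0 = 0"
  proof -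
    \<comment> \<open>The truncation at 0 is the zero function only on \<open>topspace X\<close>, so
      its value is found by monotonicity rather than by rewriting.\<close>
    have "\<mu> (\<lambda>x. min (f x) 0) \<le> \<mu> (\<lambda>_. 0)"
      using min_mem[OF f order.refl] const_mem[of 0] by (intro mono) auto
    then show ?thesis
      using nonneg[OF min_mem[OF f order.refl]] zero by (simp add: D_def)
  qed
  moreover have "\<mu> (\<lambda>x. min (f x) M) = \<mu> f"
    using M min_mem[OF f M(1)] f by (intro antisym mono) auto
  moreover have "choquet_integral X capacity_of f = integral {0..M} h"
    using choquet_integral_eq_bounded[OF capacity_of_in_capacities M(2)]
      set_borel_integral_eq_integral(2)[OF int] by (simp add: h_def[abs_def])
  ultimately show ?thesis
    by (simp add: D_def)
qed

end

section \<open>Thickening subpartitions\<close>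

text \<open>With nonnegative weights, the sum at x exceeds r exactly if x lies in all A i with i in
  some T of total weight above r; the indices of the sets containing x form such a T. Thus the set
  is a finite union of intersections of closed sets, although the inequality is strict.\<close>

lemma closedin_weighted_overlap:
  fixes c :: "'i \<Rightarrow> real"
  assumes "finite I" "\<And>i. i \<in> I \<Longrightarrow> 0 \<le> c i" "\<And>i. i \<in> I \<Longrightarrow> closedin X (A i)"
  shows "closedin X {x \<in> topspace X. r < (\<Sum>i\<in>I. c i * indicator (A i) x)}"
proof -
  let ?T = "{T. T \<subseteq> I \<and> r < sum c T}"
  have "{x \<in> topspace X. r < (\<Sum>i\<in>I. c i * indicator (A i) x)}
      = (\<Union>T\<in>?T. topspace X \<inter> (\<Inter>i\<in>T. A i))" (is "?L = ?R")
  proof (intro equalityI subsetI)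
    fix x assume x: "x \<in> ?L"
    have "(\<Sum>i\<in>I. c i * indicator (A i) x) = sum c {i\<in>I. x \<in> A i}"
      using assms(1) by (simp add: indicator_def if_distrib sum.If_cases Int_def cong: if_cong)
    with x show "x \<in> ?R"
      by (auto intro!: exI[of _ "{i\<in>I. x \<in> A i}"])
  next
    fix x assume "x \<in> ?R"
    then obtain T where T: "T \<subseteq> I" "r < sum c T" "x \<in> topspace X" "\<forall>i\<in>T. x \<in> A i"
      by auto
    have "sum c T = (\<Sum>i\<in>T. c i * indicator (A i) x)"
      using T(4) by (intro sum.cong) auto
    also have "\<dots> \<le> (\<Sum>i\<in>I. c i * indicator (A i) x)"
      using assms(1,2) T(1) by (intro sum_mono2) auto
    finally show "x \<in> ?L"
      using T(2,3) by simp
  qed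
  moreover have "closedin X ?R"
  proof (rule closedin_Union)
    show "finite ((\<lambda>T. topspace X \<inter> (\<Inter>i\<in>T. A i)) ` ?T)"
      using assms(1) by simp
    fix S assume "S \<in> (\<lambda>T. topspace X \<inter> (\<Inter>i\<in>T. A i)) ` ?T"
    \<comment> \<open>Inserting the whole space keeps the intersected family nonempty when T is
      empty, which can occur for negative r.\<close>
    then obtain T where T: "T \<subseteq> I" "S = \<Inter> (insert (topspace X) (A ` T))"
      by auto
    show "closedin X S"
      unfolding T(2) using T(1) assms(3) by (intro closedin_Inter) auto
  qed
  ultimately show ?thesis
    by simp
qed

text \<open>The set to be avoided when \<open>A i\<close> is enlarged is the closed set of points at which the other
  members leave no room for the weight \<open>c i\<close>.\<close>

lemma subpartition_thicken_one:
  assumes "normal_space X" and sub: "subpartition X n c A" and i: "i \<in> {1..n}"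
  shows "\<exists>B \<phi>. subpartition X n c (A(i := B)) \<and> \<phi> \<in> nonneg_cfuns X \<and>
    (\<forall>x\<in>topspace X. indicator (A i) x \<le> \<phi> x \<and> \<phi> x \<le> 1 \<and> (0 < \<phi> x \<longrightarrow> x \<in> B))"
proof -
  have c: "\<And>j. j \<in> {1..n} \<Longrightarrow> 0 \<le> c j" and A: "\<And>j. j \<in> {1..n} \<Longrightarrow> closedin X (A j)"
    and le1: "\<And>x. x \<in> topspace X \<Longrightarrow> (\<Sum>j=1..n. c j * indicator (A j) x) \<le> 1"
    using sub by (auto simp: subpartition_def)
  define rest where "rest x = (\<Sum>j\<in>{1..n} - {i}. c j * indicator (A j) x)" for x
  \<comment> \<open>The set S stays arbitrary: S = A i recovers the given sum, and S = B will give
    the thickened one.\<close>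
  have split: "(\<Sum>j=1..n. c j * indicator ((A(i := S)) j) x) = c i * indicator S x + rest x" for S x
    using i by (subst sum.remove[of _ i]) (auto simp: rest_def intro: sum.cong)
  define C where "C = {x \<in> topspace X. 1 - c i < rest x}"
  have "closedin X C"
    unfolding C_def rest_def using c A by (intro closedin_weighted_overlap) auto
  \<comment> \<open>At a point of A i the given bound reads c i + rest x \<le> 1, which contradicts
    membership in C.\<close>
  moreover have "disjnt C (A i)"
    using le1 split[of "A i"] by (fastforce simp: C_def disjnt_iff)
  \<comment> \<open>The range from -1 to 1 leaves room at level 0: {\<psi> \<ge> 0} is closed and
    misses C, while the positive part of \<psi> is still 1 on A i and is positive only inside that
    set.\<close>
  ultimately obtain \<psi> where \<psi>: "continuous_map X (top_of_set {-1..1::real}) \<psi>"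
    "\<psi> ` C \<subseteq> {-1}" "\<psi> ` A i \<subseteq> {1}"
    using Urysohn_lemma[OF assms(1) _ A[OF i], of C "-1" 1] by auto
  have cont: "continuous_map X euclideanreal \<psi>" and le: "\<And>x. x \<in> topspace X \<Longrightarrow> \<psi> x \<le> 1"
    using \<psi>(1) by (auto simp: continuous_map_in_subtopology)
  define B where "B = {x \<in> topspace X. 0 \<le> \<psi> x}"
  have "closedin X B"
    unfolding B_def by (rule closedin_superlevel[OF cont])
  have "c i * indicator B x + rest x \<le> 1" if x: "x \<in> topspace X" for x
  proof (cases "x \<in> B")
    case True
    then have "x \<notin> C"
      using \<psi>(2) by (auto simp: B_def)
    then show ?thesis
      using x True by (simp add: C_def)
  next
    \<comment> \<open>Outside B only the other members count, and their sum is already bounded by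
      the original one.\<close>
    case False
    have "0 \<le> c i * indicator (A i) x"
      using c[OF i] by simp
    then show ?thesis
      using le1[OF x] split[of "A i" x] False by simp
  qed
  then have "subpartition X n c (A(i := B))"
    using c A \<open>closedin X B\<close> unfolding subpartition_def split by simp
  moreover have "(\<lambda>x. max 0 (\<psi> x)) \<in> nonneg_cfuns X"
    using cont by (auto simp: nonneg_cfuns_iff intro: continuous_map_real_max)
  moreover have "indicator (A i) x \<le> max 0 (\<psi> x) \<and> max 0 (\<psi> x) \<le> 1 \<and> (0 < max 0 (\<psi> x) \<longrightarrow> x \<in> B)"
    if "x \<in> topspace X" for x
    using that le[OF that] \<psi>(3) by (auto simp: indicator_def B_def)
  ultimately show ?thesis
    by (intro exI[of _ B] exI[of _ "\<lambda>x. max 0 (\<psi> x)"]) blast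
qed

text \<open>Induction on the number m of members already thickened. Each step works in the current
  subpartition, so the bound 1 accounts for all earlier enlargements. The invariant B i = A i for i
  > m ensures that the next Urysohn function majorizes the original set.\<close>

lemma subpartition_thicken:
  assumes "normal_space X" and sub: "subpartition X n c A"
  obtains B \<phi> where "subpartition X n c B"
    and "\<And>i. i \<in> {1..n} \<Longrightarrow> \<phi> i \<in> nonneg_cfuns X"
    and "\<And>i x. i \<in> {1..n} \<Longrightarrow> x \<in> topspace X \<Longrightarrow>
      indicator (A i) x \<le> \<phi> i x \<and> \<phi> i x \<le> 1 \<and> (0 < \<phi> i x \<longrightarrow> x \<in> B i)"
proof -
  have "\<exists>B \<phi>. subpartition X n c B \<and> (\<forall>i>m. B i = A i) \<and> (\<forall>i\<in>{1..m}. \<phi> i \<in> nonneg_cfuns X \<and>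
      (\<forall>x\<in>topspace X. indicator (A i) x \<le> \<phi> i x \<and> \<phi> i x \<le> 1 \<and> (0 < \<phi> i x \<longrightarrow> x \<in> B i)))"
    if "m \<le> n" for m
    using that
  proof (induction m)
    case 0
    show ?case
      using sub by (intro exI[of _ A]) simp
  next
    case (Suc m)
    then obtain B \<phi> where B: "subpartition X n c B" "\<forall>i>m. B i = A i"
      and \<phi>: "\<forall>i\<in>{1..m}. \<phi> i \<in> nonneg_cfuns X \<and>
        (\<forall>x\<in>topspace X. indicator (A i) x \<le> \<phi> i x \<and> \<phi> i x \<le> 1 \<and> (0 < \<phi> i x \<longrightarrow> x \<in> B i))"
      by auto
    have "Suc m \<in> {1..n}"
      using Suc.prems by simp
    from subpartition_thicken_one[OF assms(1) B(1) this] obtain B' \<phi>'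
      where "subpartition X n c (B(Suc m := B'))" "\<phi>' \<in> nonneg_cfuns X"
        "\<forall>x\<in>topspace X. indicator (B (Suc m)) x \<le> \<phi>' x \<and> \<phi>' x \<le> 1 \<and> (0 < \<phi>' x \<longrightarrow> x \<in> B')"
      by blast
    with B \<phi> show ?case
      by (intro exI[of _ "B(Suc m := B')"] exI[of _ "\<phi>(Suc m := \<phi>')"])
         (auto simp: atLeastAtMostSuc_conv simp del: fun_upd_apply, auto)
  qed
  from this[OF order.refl] that show ?thesis
    by blast
qed

text \<open>For t > 0 the superlevel sets of the \<phi> i lie in the B i and so form a subpartition
  with the same weights. Balancedness bounds the integrand at each such level by 1, and since \<phi>
  i \<le> 1 only levels in an interval of length 1 contribute.\<close>

lemma balanced_capacity_imp_sum_choquet_le: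
  assumes \<nu>: "\<nu> \<in> balanced_capacities X" and B: "subpartition X n c B"
    and \<phi>: "\<And>i. i \<in> {1..n} \<Longrightarrow> \<phi> i \<in> nonneg_cfuns X"
    and le1: "\<And>i x. i \<in> {1..n} \<Longrightarrow> x \<in> topspace X \<Longrightarrow> \<phi> i x \<le> 1"
    and supp: "\<And>i x. i \<in> {1..n} \<Longrightarrow> x \<in> topspace X \<Longrightarrow> 0 < \<phi> i x \<Longrightarrow> x \<in> B i"
  shows "(\<Sum>i=1..n. c i * choquet_integral X \<nu> (\<phi> i)) \<le> 1"
proof -
  have cap: "\<nu> \<in> capacities X"
    using \<nu> by (simp add: balanced_capacities_def)
  define h where "h i t = \<nu> {x \<in> topspace X. t \<le> \<phi> i x}" for i t
  have int: "set_integrable lborel {0..1} (h i)" if "i \<in> {1..n}" for i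
    unfolding h_def using set_integrable_capacity_superlevel[OF cap \<phi>[OF that]] .
  \<comment> \<open>Level 0 is excluded because there every superlevel set is the whole
    space.\<close>
  have level: "(\<Sum>i=1..n. c i * h i t) \<le> 1" if "0 < t" for t
  proof -
    have "subpartition X n c (\<lambda>i. {x \<in> topspace X. t \<le> \<phi> i x})"
      unfolding subpartition_def
    proof (intro conjI ballI)
      fix x assume x: "x \<in> topspace X"
      have "(\<Sum>i=1..n. c i * indicator {x \<in> topspace X. t \<le> \<phi> i x} x)
          \<le> (\<Sum>i=1..n. c i * indicator (B i) x)"
      proof (intro sum_mono mult_left_mono)
        fix i assume i: "i \<in> {1..n}"
        show "indicator {x \<in> topspace X. t \<le> \<phi> i x} x \<le> (indicator (B i) x :: real)"
          using supp[OF i x] \<open>0 < t\<close> by (auto simp: indicator_def)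
        show "0 \<le> c i"
          using B i by (simp add: subpartition_def)
      qed
      also have "\<dots> \<le> 1"
        using B x by (simp add: subpartition_def)
      finally show "(\<Sum>i=1..n. c i * indicator {x \<in> topspace X. t \<le> \<phi> i x} x) \<le> 1" .
    qed (use B \<phi> in \<open>auto intro!: closedin_superlevel simp: subpartition_def nonneg_cfuns_iff\<close>)
    then show ?thesis
      using \<nu> by (auto simp: balanced_capacities_def h_def)
  qed
  have "(\<Sum>i=1..n. c i * choquet_integral X \<nu> (\<phi> i)) = (\<Sum>i=1..n. LBINT t:{0..1}. c i * h i t)"
    using le1 by (intro sum.cong) (simp_all add: choquet_integral_eq_bounded[OF cap] h_def)
  also have "\<dots> = (LBINT t:{0..1}. \<Sum>i=1..n. c i * h i t)"
    unfolding set_lebesgue_integral_def scaleR_sum_right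
    by (intro Bochner_Integration.integral_sum[symmetric])
       (metis int set_integrable_mult_right set_integrable_def)
  also have "\<dots> \<le> (LBINT t:{0..1::real}. 1)"
  proof (rule set_integral_mono_AE)
    show "set_integrable lborel {0..1} (\<lambda>t. \<Sum>i=1..n. c i * h i t)"
      unfolding set_integrable_def scaleR_sum_right
      by (intro Bochner_Integration.integrable_sum)
         (metis int set_integrable_mult_right set_integrable_def)
    \<comment> \<open>The exceptional level 0 is a null set.\<close>
    show "AE t\<in>{0..1} in lborel. (\<Sum>i=1..n. c i * h i t) \<le> 1"
      using AE_lborel_singleton[of "0::real"] by eventually_elim (use level in force)
  qed (simp add: set_integrable_def integrable_indicator_iff)
  also have "\<dots> = 1"
    by (simp add: set_integral_const)
  finally show ?thesis .
qed

section \<open>Equivalence of balancedness for functionals and capacities\<close>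

theorem theorem2:
  fixes X :: "'a topology" and \<mu> :: "('a \<Rightarrow> real) \<Rightarrow> real"
  assumes "compact_space X" and "Hausdorff_space X"
    and "\<mu> \<in> comonotone_functionals X"
  shows "\<mu> \<in> balanced_functionals X \<longleftrightarrow>
    (\<exists>\<nu>\<in>balanced_capacities X. \<forall>\<phi>\<in>nonneg_cfuns X. \<mu> \<phi> = choquet_integral X \<nu> \<phi>)"
proof
  interpret comonotone_functional X \<mu>
    by unfold_locales (rule assms(3))
  assume bal: "\<mu> \<in> balanced_functionals X"
  have "(\<Sum>i=1..n. c i * capacity_of (A i)) \<le> 1" if sub: "subpartition X n c A" for n c A
  proof -
    \<comment> \<open>The functions provided by balancedness of \<mu> are majorants of the A i, so
      they bound the infima defining \<open>capacity_of\<close>.\<close>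
    obtain f where f: "\<forall>i\<in>{1..n}. f i \<in> majorants (A i)" "(\<Sum>i=1..n. c i * \<mu> (f i)) \<le> 1"
      using bal sub unfolding balanced_functionals_def majorants_def by blast
    have "(\<Sum>i=1..n. c i * capacity_of (A i)) \<le> (\<Sum>i=1..n. c i * \<mu> (f i))"
      using f(1) sub by (intro sum_mono mult_left_mono capacity_of_le) (auto simp: subpartition_def)
    with f(2) show ?thesis
      by simp
  qed
  then have "capacity_of \<in> balanced_capacities X"
    using capacity_of_in_capacities by (simp add: balanced_capacities_def)
  then show "\<exists>\<nu>\<in>balanced_capacities X. \<forall>\<phi>\<in>nonneg_cfuns X. \<mu> \<phi> = choquet_integral X \<nu> \<phi>"
    using choquet_representation[OF assms(1)] by blast
next
  assume "\<exists>\<nu>\<in>balanced_capacities X. \<forall>\<phi>\<in>nonneg_cfuns X. \<mu> \<phi> = choquet_integral X \<nu> \<phi>"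
  then obtain \<nu> where \<nu>: "\<nu> \<in> balanced_capacities X"
    and rep: "\<And>\<phi>. \<phi> \<in> nonneg_cfuns X \<Longrightarrow> \<mu> \<phi> = choquet_integral X \<nu> \<phi>"
    by blast
  have normal: "normal_space X"
    using assms(1,2) by (simp add: compact_Hausdorff_or_regular_imp_normal_space)
  have "\<exists>f. (\<forall>i\<in>{1..n}. f i \<in> nonneg_cfuns X \<and> (\<forall>x\<in>topspace X. indicator (A i) x \<le> f i x)) \<and>
      (\<Sum>i=1..n. c i * \<mu> (f i)) \<le> 1" if sub: "subpartition X n c A" for n c A
  proof -
    obtain B \<phi> where B: "subpartition X n c B"
      and \<phi>: "\<And>i. i \<in> {1..n} \<Longrightarrow> \<phi> i \<in> nonneg_cfuns X"
        "\<And>i x. i \<in> {1..n} \<Longrightarrow> x \<in> topspace X \<Longrightarrow>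
          indicator (A i) x \<le> \<phi> i x \<and> \<phi> i x \<le> 1 \<and> (0 < \<phi> i x \<longrightarrow> x \<in> B i)"
      using subpartition_thicken[OF normal sub] by blast
    \<comment> \<open>The Urysohn functions of the thickened sets serve as the required
      witnesses.\<close>
    have "(\<Sum>i=1..n. c i * \<mu> (\<phi> i)) = (\<Sum>i=1..n. c i * choquet_integral X \<nu> (\<phi> i))"
      using rep \<phi>(1) by (intro sum.cong) auto
    also have "\<dots> \<le> 1"
      using \<phi> by (intro balanced_capacity_imp_sum_choquet_le[OF \<nu> B]) auto
    finally show ?thesis
      using \<phi> by (intro exI[of _ \<phi>]) auto
  qed
  then show "\<mu> \<in> balanced_functionals X"
    using assms(3) by (simp add: balanced_functionals_def)
qed

end
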